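(* Let $l\ge1$ and let $J$ be a block Jacobi matrix with $l\times l$ Jacobi parameters $(A_n)_{n\ge1}$, $(B_n)_{n\ge1}$ satisfying $$\sum_{n=1}^\infty\left[\,\|\mathbf{1}-A_nA_n^*\|+\|B_n\|\,\right]<\infty .$$ Let $J^{(1)},J^{(2)},J^{(3)}$ be the (unique) block Jacobi matrices of type $1$, type $2$ and type $3$, respectively, that are equivalent to $J$. Then $J^{(1)},J^{(2)},J^{(3)}$ are pairwise asymptotic to each other.
   Context: All matrices are $l\times l$ with complex entries; $\mathbf{1}$ and $\mathbf{0}$ denote the $l\times l$ identity and zero matrices; $T^*$ is the conjugate transpose; $T>0$ means that $T$ is Hermitian positive definite; $\|\cdot\|$ is the operator norm on $l\times l$ matrices (all norms on this finite-dimensional space are equivalent, so the choice is immaterial). A block Jacobi matrix is an infinite block tridiagonal matrix $$J=\begin{pmatrix} B_1&A_1&\mathbf{0}&\\ A_1^*&B_2&A_2&\ddots\\ \mathbf{0}&A_2^*&B_3&\ddots\\ &\ddots&\ddots&\ddots\end{pmatrix},$$ where $A_n,B_n$ $(n\ge1)$ are $l\times l$ matrices with every $A_n$ invertible. The sequences $(A_n)$, $(B_n)$ are called the Jacobi parameters of $J$. Two block Jacobi matrices $J$ and $\widetilde J$ with Jacobi parameters $(A_n),(B_n)$ and $(\widetilde A_n),(\widetilde B_n)$ are called equivalent if there are unitary $l\times l$ matrices $\sigma_n$ $(n\ge1)$ with $\sigma_1=\mathbf{1}$ such that for all $n\ge 1$ $$\widetilde A_n=\sigma_n^*A_n\sigma_{n+1},\qquad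 \widetilde B_n=\sigma_n^*B_n\sigma_n .$$ Two equivalent block Jacobi matrices $J$ and $\widetilde J$, related in this way by the unitaries $\sigma_n$, are called asymptotic to each other if the limit $\lim_{n\to\infty}\sigma_n$ exists. A block Jacobi matrix is of type $1$ if $A_n>0$ for all $n$; of type $2$ if $A_1A_2\cdots A_n>0$ for all $n$; and of type $3$ if every $A_n$ is lower triangular with strictly positive elements on the diagonal. Each equivalence class of block Jacobi matrices contains exactly one matrix of type $1$, exactly one of type $2$ and exactly one of type $3$ (a known fact following from uniqueness of the polar and QR decompositions). *)

theory Defs
  imports "HOL-Analysis.Analysis"
begin

type_synonym 'l cmat = "complex ^ 'l ^ 'l"

definition conj_transpose :: "'l::finite cmat \<Rightarrow> 'l cmat"
  where "conj_transpose T = (\<chi> i j. cnj (T $ j $ i))"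

definition unitary_mat :: "'l::finite cmat \<Rightarrow> bool"
  where "unitary_mat U \<longleftrightarrow>
    conj_transpose U ** U = mat 1 \<and> U ** conj_transpose U = mat 1"

text \<open>For Hermitian \<open>T\<close> the quadratic form below is real-valued, so taking its real part
  loses nothing.\<close>

definition pos_def :: "'l::finite cmat \<Rightarrow> bool"
  where "pos_def T \<longleftrightarrow> conj_transpose T = T \<and>
    (\<forall>x. x \<noteq> 0 \<longrightarrow> 0 < Re (\<Sum>i\<in>UNIV. cnj (x $ i) * (T *v x) $ i))"

text \<open>Rows and columns are ordered by the linear order on the index type. A strictly positive
  complex entry is a real one.\<close>

definition lower_triangular_pos :: "'l::{finite,linorder} cmat \<Rightarrow> bool"
  where "lower_triangular_pos T \<longleftrightarrow>
    (\<forall>i j. i < j \<longrightarrow> T $ i $ j = 0) \<and> (\<forall>i. Im (T $ i $ i) = 0 \<and> 0 < Re (T $ i $ i))"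

definition op_norm :: "'l::finite cmat \<Rightarrow> real"
  where "op_norm T = onorm (\<lambda>x. T *v x)"

text \<open>An infinite block matrix is a function of its block row and block column. Indices start
  at \<open>1\<close>; entries with an index \<open>0\<close> are junk and are never referred to.\<close>

type_synonym 'l block_matrix = "nat \<Rightarrow> nat \<Rightarrow> 'l cmat"

definition jacobi_A :: "'l block_matrix \<Rightarrow> nat \<Rightarrow> 'l cmat"
  where "jacobi_A J n = J n (n + 1)"

definition jacobi_B :: "'l block_matrix \<Rightarrow> nat \<Rightarrow> 'l cmat"
  where "jacobi_B J n = J n n"

text \<open>The diagonal blocks are arbitrary; in particular they need not be Hermitian.\<close>

definition block_jacobi :: "'l::finite block_matrix \<Rightarrow> bool"
  where "block_jacobi J \<longleftrightarrow>
    (\<forall>n\<ge>1. invertible (jacobi_A J n)) \<and>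
    (\<forall>n\<ge>1. J (n + 1) n = conj_transpose (jacobi_A J n)) \<and>
    (\<forall>i\<ge>1. \<forall>j\<ge>1. i + 1 < j \<or> j + 1 < i \<longrightarrow> J i j = 0)"

definition equivalent_via ::
    "(nat \<Rightarrow> 'l::finite cmat) \<Rightarrow> 'l block_matrix \<Rightarrow> 'l block_matrix \<Rightarrow> bool"
  where "equivalent_via \<sigma> J J' \<longleftrightarrow>
    (\<forall>n\<ge>1. unitary_mat (\<sigma> n)) \<and> \<sigma> 1 = mat 1 \<and>
    (\<forall>n\<ge>1. jacobi_A J' n = conj_transpose (\<sigma> n) ** jacobi_A J n ** \<sigma> (n + 1) \<and>
            jacobi_B J' n = conj_transpose (\<sigma> n) ** jacobi_B J n ** \<sigma> n)"

definition jacobi_equivalent :: "'l::finite block_matrix \<Rightarrow> 'l block_matrix \<Rightarrow> bool"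
  where "jacobi_equivalent J J' \<longleftrightarrow>
    block_jacobi J \<and> block_jacobi J' \<and> (\<exists>\<sigma>. equivalent_via \<sigma> J J')"

text \<open>For block Jacobi matrices, \<open>\<sigma> 1 = mat 1\<close> and invertibility of the off-diagonal blocks
  determine the unitaries \<open>\<sigma> n\<close> for \<open>n \<ge> 1\<close> uniquely, so the existential quantifier speaks
  about the only possible sequence.\<close>

definition jacobi_asymptotic :: "'l::finite block_matrix \<Rightarrow> 'l block_matrix \<Rightarrow> bool"
  where "jacobi_asymptotic J J' \<longleftrightarrow>
    block_jacobi J \<and> block_jacobi J' \<and> (\<exists>\<sigma>. equivalent_via \<sigma> J J' \<and> convergent \<sigma>)"

primrec ordered_prod :: "(nat \<Rightarrow> 'l::finite cmat) \<Rightarrow> nat \<Rightarrow> 'l cmat" where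
  "ordered_prod A 0 = mat 1"
| "ordered_prod A (Suc n) = ordered_prod A n ** A (Suc n)"

definition type1 :: "'l::finite block_matrix \<Rightarrow> bool"
  where "type1 J \<longleftrightarrow> block_jacobi J \<and> (\<forall>n\<ge>1. pos_def (jacobi_A J n))"

definition type2 :: "'l::finite block_matrix \<Rightarrow> bool"
  where "type2 J \<longleftrightarrow> block_jacobi J \<and> (\<forall>n\<ge>1. pos_def (ordered_prod (jacobi_A J) n))"

definition type3 :: "'l::{finite,linorder} block_matrix \<Rightarrow> bool"
  where "type3 J \<longleftrightarrow> block_jacobi J \<and> (\<forall>n\<ge>1. lower_triangular_pos (jacobi_A J n))"

end

theory Submission
  imports Defs
begin

text \<open>
  Write \<open>P\<^sub>n = A\<^sub>1 \<cdots> A\<^sub>n\<close>. If \<open>J'\<close> is equivalent to \<open>J\<close> through unitaries \<open>\<sigma>\<^sub>n\<close>, the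
  products telescope to \<open>P'\<^sub>n = P\<^sub>n \<sigma>\<^sub>n\<^sub>+\<^sub>1\<close> (lemma \<open>ordered_prod_equivalent\<close>). So \<open>\<sigma>\<^sub>n\<close>
  converges as soon as \<open>P\<^sub>n\<^sup>-\<^sup>1\<close> and \<open>P'\<^sub>n\<close> do, and the theorem reduces to the convergence of the
  products for each of the three types, and of the inverse products for type 1: types 2 and 3 are
  compared with type 1, and with each other through it.

  The defect \<open>E\<^sub>n = 1 - A\<^sub>n A\<^sub>n\<^sup>*\<close> is only conjugated by a unitary when \<open>J\<close> is replaced by
  \<open>J'\<close>, so all three matrices have summable defects. In types 1 and 3 the normalization of
  \<open>A\<^sub>n\<close> is rigid enough that \<open>\<parallel>A\<^sub>n - 1\<parallel>\<close> is bounded by a constant times \<open>\<parallel>E\<^sub>n\<parallel>\<close>, at least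
  for small \<open>E\<^sub>n\<close> (lemmas \<open>pos_def_norm_diff_mat_1_le\<close> and
  \<open>lower_triangular_pos_norm_diff_mat_1_le\<close>). Hence \<open>\<Sum> \<parallel>A\<^sub>n - 1\<parallel> < \<infinity>\<close>, and the products and
  their inverses converge.

  For type 2 the factors themselves carry no normalization, but \<open>P\<^sub>n\<close> is the positive definite
  square root of \<open>P\<^sub>n P\<^sub>n\<^sup>*\<close>, which does not change within the equivalence class and therefore
  converges because it does so for type 1. The square root is Lipschitz away from singular matrices
  (lemma \<open>pos_def_norm_diff_le\<close>), which makes \<open>P\<^sub>n\<close> a Cauchy sequence.

  All estimates use the Frobenius norm, which is the Euclidean norm of the space of matrices. Its
  inner product, the real part of the trace of \<open>A\<^sup>* B\<close>, replaces spectral theory throughout: the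
  adjoint of a multiplication is the multiplication by the conjugate transpose.
\<close>

section \<open>The Frobenius inner product\<close>

lemma matrix_mult_entry: "(A ** B) $ i $ j = (\<Sum>k\<in>UNIV. A $ i $ k * B $ k $ j)"
  by (simp add: matrix_matrix_mult_def)

lemma conj_transpose_entry [simp]: "conj_transpose A $ i $ j = cnj (A $ j $ i)"
  by (simp add: conj_transpose_def)

lemma conj_transpose_conj_transpose [simp]: "conj_transpose (conj_transpose A) = A"
  by (simp add: vec_eq_iff)

lemma conj_transpose_mat_1 [simp]: "conj_transpose (mat 1) = mat 1"
  by (simp add: vec_eq_iff mat_def)

lemma conj_transpose_diff: "conj_transpose (A - B) = conj_transpose A - conj_transpose B"
  by (simp add: vec_eq_iff)

lemma conj_transpose_mult:
  "conj_transpose (A ** B) = conj_transpose B ** conj_transpose A"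
  by (simp add: vec_eq_iff matrix_mult_entry mult.commute)

lemma inner_conj_transpose:
  "conj_transpose A \<bullet> conj_transpose B = A \<bullet> B"
  by (simp add: inner_vec_def inner_complex_def) (rule sum.swap)

lemma norm_conj_transpose: "norm (conj_transpose A) = norm A"
  by (simp add: norm_eq_sqrt_inner inner_conj_transpose)

lemma inner_matrix_Re:
  fixes A B :: "'l::finite cmat"
  shows "A \<bullet> B = Re (\<Sum>i\<in>UNIV. \<Sum>j\<in>UNIV. cnj (A $ i $ j) * B $ i $ j)"
  by (simp add: inner_vec_def inner_complex_def)

lemma inner_mult_adjoint_left:
  fixes A B C :: "'l::finite cmat"
  shows "(A ** B) \<bullet> C = B \<bullet> (conj_transpose A ** C)"
proof -
  have "(\<Sum>i\<in>UNIV. \<Sum>j\<in>UNIV. cnj ((A ** B) $ i $ j) * C $ i $ j)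
      = (\<Sum>i\<in>UNIV. \<Sum>j\<in>UNIV. \<Sum>k\<in>UNIV. cnj (A $ i $ k) * cnj (B $ k $ j) * C $ i $ j)"
    by (simp add: matrix_mult_entry sum_distrib_right)
  also have "\<dots> = (\<Sum>i\<in>UNIV. \<Sum>k\<in>UNIV. \<Sum>j\<in>UNIV. cnj (A $ i $ k) * cnj (B $ k $ j) * C $ i $ j)"
    by (intro sum.cong refl sum.swap)
  also have "\<dots> = (\<Sum>k\<in>UNIV. \<Sum>i\<in>UNIV. \<Sum>j\<in>UNIV. cnj (A $ i $ k) * cnj (B $ k $ j) * C $ i $ j)"
    by (rule sum.swap)
  also have "\<dots> = (\<Sum>k\<in>UNIV. \<Sum>j\<in>UNIV. \<Sum>i\<in>UNIV. cnj (A $ i $ k) * cnj (B $ k $ j) * C $ i $ j)"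
    by (intro sum.cong refl sum.swap)
  also have "\<dots> = (\<Sum>k\<in>UNIV. \<Sum>j\<in>UNIV. cnj (B $ k $ j) * (conj_transpose A ** C) $ k $ j)"
    by (simp add: matrix_mult_entry sum_distrib_left mult_ac)
  finally show ?thesis
    by (simp only: inner_matrix_Re)
qed

lemma inner_mult_adjoint_right:
  fixes A B C :: "'l::finite cmat"
  shows "(A ** B) \<bullet> C = A \<bullet> (C ** conj_transpose B)"
proof -
  have "(A ** B) \<bullet> C = (conj_transpose B ** conj_transpose A) \<bullet> conj_transpose C"
    by (metis conj_transpose_mult inner_conj_transpose)
  also have "\<dots> = conj_transpose A \<bullet> conj_transpose (C ** conj_transpose B)"
    by (simp add: inner_mult_adjoint_left conj_transpose_mult)
  finally show ?thesis
    by (simp add: inner_conj_transpose)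
qed

text \<open>Each row of \<open>A ** B\<close> is a combination of the rows of \<open>B\<close>, so the Cauchy--Schwarz inequality
  bounds it by the norm of the corresponding row of \<open>A\<close>.\<close>

lemma norm_matrix_mult_le:
  fixes A B :: "'l::finite cmat"
  shows "norm (A ** B) \<le> norm A * norm B"
proof -
  have row: "norm ((A ** B) $ i) \<le> norm (A $ i) * norm B" for i
  proof -
    have "(A ** B) $ i = (\<Sum>k\<in>UNIV. A $ i $ k *s B $ k)"
      by (simp add: vec_eq_iff matrix_mult_entry)
    hence "norm ((A ** B) $ i) \<le> (\<Sum>k\<in>UNIV. norm (A $ i $ k *s B $ k))"
      by (simp add: norm_sum)
    also have "\<dots> = (\<Sum>k\<in>UNIV. \<bar>norm (A $ i $ k)\<bar> * \<bar>norm (B $ k)\<bar>)"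
      by (simp add: norm_vec_def L2_set_right_distrib norm_mult)
    also have "\<dots> \<le> norm (A $ i) * norm B"
      unfolding norm_vec_def[of "A $ i"] norm_vec_def[of B] by (rule L2_set_mult_ineq)
    finally show ?thesis .
  qed
  have "norm (A ** B) \<le> L2_set (\<lambda>i. norm (A $ i) * norm B) UNIV"
    unfolding norm_vec_def[of "A ** B"] by (rule L2_set_mono) (simp_all add: row)
  also have "\<dots> = norm A * norm B"
    by (simp add: norm_vec_def[of A] L2_set_left_distrib)
  finally show ?thesis .
qed

lemma bounded_bilinear_matrix_mult:
  "bounded_bilinear ((**) :: 'l::finite cmat \<Rightarrow> 'l cmat \<Rightarrow> 'l cmat)"
proof (rule bounded_bilinear.intro)
  show "\<exists>K. \<forall>(A :: 'l cmat) (B :: 'l cmat). norm (A ** B) \<le> norm A * norm B * K"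
    by (intro exI[of _ 1]) (simp add: norm_matrix_mult_le)
qed (simp_all add: vec_eq_iff matrix_mult_entry algebra_simps sum.distrib scaleR_sum_right)

lemmas matrix_mult_diff_left = bounded_bilinear.diff_left[OF bounded_bilinear_matrix_mult]
lemmas matrix_mult_diff_right = bounded_bilinear.diff_right[OF bounded_bilinear_matrix_mult]
lemmas matrix_mult_scaleR_right = bounded_bilinear.scaleR_right[OF bounded_bilinear_matrix_mult]

lemma convergent_matrix_mult:
  fixes X Y :: "nat \<Rightarrow> 'l::finite cmat"
  assumes "convergent X" and "convergent Y"
  shows "convergent (\<lambda>n. X n ** Y n)"
  using assms bounded_bilinear.tendsto[OF bounded_bilinear_matrix_mult]
  unfolding convergent_def by blast

lemma convergent_conj_transpose:
  fixes X :: "nat \<Rightarrow> 'l::finite cmat"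
  assumes "convergent X"
  shows "convergent (\<lambda>n. conj_transpose (X n))"
proof -
  obtain L where L: "X \<longlonglongrightarrow> L"
    using assms by (auto simp: convergent_def)
  have "(\<lambda>n. conj_transpose (X n)) \<longlonglongrightarrow> conj_transpose L"
    unfolding conj_transpose_def by (intro tendsto_intros L)
  thus ?thesis
    by (rule convergentI)
qed

lemma norm_unitary_mult_left:
  fixes U A :: "'l::finite cmat"
  assumes "unitary_mat U"
  shows "norm (U ** A) = norm A"
  using assms
  by (simp add: norm_eq_sqrt_inner inner_mult_adjoint_left matrix_mul_assoc unitary_mat_def)

lemma norm_unitary_mult_right:
  fixes U A :: "'l::finite cmat"
  assumes "unitary_mat U"
  shows "norm (A ** U) = norm A"
  using assms
  by (simp add: norm_eq_sqrt_inner inner_mult_adjoint_right matrix_mul_assoc[symmetric]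
      unitary_mat_def)

lemma unitary_mat_conj_transpose: "unitary_mat U \<Longrightarrow> unitary_mat (conj_transpose U)"
  by (simp add: unitary_mat_def)

lemma unitary_mat_mult:
  assumes "unitary_mat U" and "unitary_mat V"
  shows "unitary_mat (U ** V)"
  using assms unfolding unitary_mat_def conj_transpose_mult
  by (metis matrix_mul_assoc matrix_mul_lid)

text \<open>The crude constant suffices: the bound only serves to transfer summability to the Frobenius
  norm.\<close>

lemma norm_le_op_norm:
  fixes M :: "'l::finite cmat"
  shows "norm M \<le> real (CARD('l) * CARD('l)) * op_norm M"
proof -
  have entry: "norm (M $ i $ j) \<le> op_norm M" for i j
  proof -
    have "M $ i $ j = (M *v axis j 1) $ i"
      by (simp add: matrix_vector_mult_def axis_def if_distrib cong: if_cong)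
    also have "norm \<dots> \<le> norm (M *v axis j 1)"
      by (rule Finite_Cartesian_Product.norm_nth_le)
    also have "\<dots> \<le> onorm ((*v) M) * norm (axis j (1::complex))"
      by (rule onorm) simp
    finally show ?thesis
      by (simp add: op_norm_def)
  qed
  have "norm M \<le> (\<Sum>i\<in>UNIV. norm (M $ i))"
    unfolding norm_vec_def[of M] by (rule L2_set_le_sum) simp
  also have "\<dots> \<le> (\<Sum>i\<in>(UNIV::'l set). \<Sum>j\<in>(UNIV::'l set). op_norm M)"
  proof (rule sum_mono)
    fix i
    have "norm (M $ i) \<le> (\<Sum>j\<in>UNIV. norm (M $ i $ j))"
      unfolding norm_vec_def[of "M $ i"] by (rule L2_set_le_sum) simp
    also have "\<dots> \<le> (\<Sum>j\<in>(UNIV::'l set). op_norm M)"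
      by (rule sum_mono) (rule entry)
    finally show "norm (M $ i) \<le> (\<Sum>j\<in>(UNIV::'l set). op_norm M)" .
  qed
  finally show ?thesis
    by simp
qed

section \<open>Square roots of positive definite matrices\<close>

lemma pos_def_hermitian: "pos_def T \<Longrightarrow> conj_transpose T = T"
  by (simp add: pos_def_def)

text \<open>The inner product splits into one value of the quadratic form of \<open>T\<close> for each column of
  \<open>Z\<close>.\<close>

lemma pos_def_inner_nonneg:
  fixes T Z :: "'l::finite cmat"
  assumes "pos_def T"
  shows "0 \<le> Z \<bullet> (T ** Z)"
proof -
  have col: "0 \<le> Re (\<Sum>i\<in>UNIV. cnj (Z $ i $ j) * (T ** Z) $ i $ j)" for j
  proof -
    define x :: "complex ^ 'l" where "x = (\<chi> i. Z $ i $ j)"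
    have "(T *v x) $ i = (T ** Z) $ i $ j" for i
      by (simp add: x_def matrix_vector_mult_def matrix_mult_entry)
    moreover have "0 \<le> Re (\<Sum>i\<in>UNIV. cnj (x $ i) * (T *v x) $ i)"
      using assms by (cases "x = 0") (auto simp: pos_def_def intro: less_imp_le)
    ultimately show ?thesis
      by (simp add: x_def)
  qed
  have "Z \<bullet> (T ** Z) = Re (\<Sum>j\<in>UNIV. \<Sum>i\<in>UNIV. cnj (Z $ i $ j) * (T ** Z) $ i $ j)"
    by (subst sum.swap) (rule inner_matrix_Re)
  also have "\<dots> = (\<Sum>j\<in>UNIV. Re (\<Sum>i\<in>UNIV. cnj (Z $ i $ j) * (T ** Z) $ i $ j))"
    by (rule Re_sum)
  also have "\<dots> \<ge> 0"
    by (rule sum_nonneg) (rule col)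
  finally show ?thesis .
qed

text \<open>The smallest eigenvalue of \<open>S\<close> is the reciprocal of the largest eigenvalue of \<open>S\<^sup>-\<^sup>1\<close>, which is
  at most \<open>\<parallel>R\<parallel>\<close>. The resulting lower bound is what the quadratic form of \<open>S\<close> says when it is
  nonnegative at \<open>K Z - R Z\<close> with \<open>K = \<parallel>R\<parallel>\<close>.\<close>

lemma pos_def_coercive:
  fixes S R Z :: "'l::finite cmat"
  assumes S: "pos_def S" and inv: "S ** R = mat 1"
  shows "(norm Z)\<^sup>2 \<le> norm R * (Z \<bullet> (S ** Z))"
proof (cases "Z = 0")
  case True
  thus ?thesis by simp
next
  case False
  define K where "K = norm R"
  define Y where "Y = R ** Z"
  have SY: "S ** Y = Z"
    by (simp add: Y_def matrix_mul_assoc inv)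
  have YZ: "Y \<bullet> (S ** Z) = (norm Z)\<^sup>2"
    using inner_mult_adjoint_left[of S Y Z] SY pos_def_hermitian[OF S]
    by (simp add: power2_norm_eq_inner)
  have "R \<noteq> 0"
  proof
    assume "R = 0"
    hence "Y = 0" by (simp add: Y_def vec_eq_iff matrix_mult_entry)
    with YZ False show False by simp
  qed
  hence K: "0 < K" by (simp add: K_def)
  have "Y \<bullet> Z \<le> norm Y * norm Z"
    by (rule norm_cauchy_schwarz)
  also have "\<dots> \<le> K * (norm Z)\<^sup>2"
    using norm_matrix_mult_le[of R Z]
    by (simp add: Y_def K_def power2_eq_square mult.assoc[symmetric] mult_right_mono)
  finally have YZ': "Y \<bullet> Z \<le> K * (norm Z)\<^sup>2" .
  have "0 \<le> (K *\<^sub>R Z - Y) \<bullet> (S ** (K *\<^sub>R Z - Y))"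
    by (rule pos_def_inner_nonneg[OF S])
  also have "\<dots> = (K *\<^sub>R Z - Y) \<bullet> (K *\<^sub>R (S ** Z) - Z)"
    by (simp add: matrix_mult_diff_right matrix_mult_scaleR_right SY)
  also have "\<dots> = K\<^sup>2 * (Z \<bullet> (S ** Z)) - 2 * K * (norm Z)\<^sup>2 + Y \<bullet> Z"
    by (simp add: inner_diff_left inner_diff_right YZ power2_norm_eq_inner[of Z, symmetric]
        power2_eq_square[of K] algebra_simps)
  finally have "K * (norm Z)\<^sup>2 \<le> K * (K * (Z \<bullet> (S ** Z)))"
    using YZ' by (simp add: power2_eq_square)
  thus ?thesis
    using K by (simp add: K_def)
qed

text \<open>Lipschitz continuity of the positive square root. With \<open>D = S - T\<close> one has
  \<open>S\<^sup>2 - T\<^sup>2 = S D + D T\<close>. In the inner product with \<open>D\<close> both summands are nonnegative, and the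
  first is at least \<open>\<parallel>D\<parallel>\<^sup>2 / \<parallel>R\<parallel>\<close> by coercivity. The constant involves the inverse of
  only one of the two matrices.\<close>

lemma pos_def_norm_diff_le:
  fixes S T R :: "'l::finite cmat"
  assumes S: "pos_def S" and T: "pos_def T" and inv: "S ** R = mat 1"
  shows "norm (S - T) \<le> norm R * norm (S ** S - T ** T)"
proof (cases "S = T")
  case True
  thus ?thesis by simp
next
  case False
  define D where "D = S - T"
  have D: "conj_transpose D = D"
    by (simp add: D_def conj_transpose_diff pos_def_hermitian S T)
  have DT: "D \<bullet> (D ** T) = D \<bullet> (T ** D)"
    using inner_conj_transpose[of D "D ** T"]
    by (simp add: conj_transpose_mult D pos_def_hermitian[OF T])
  have split: "S ** S - T ** T = S ** D + D ** T"
    by (simp add: D_def matrix_mult_diff_left matrix_mult_diff_right)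
  have "(norm D)\<^sup>2 \<le> norm R * (D \<bullet> (S ** D))"
    by (rule pos_def_coercive[OF S inv])
  also have "\<dots> \<le> norm R * (D \<bullet> (S ** S - T ** T))"
    using pos_def_inner_nonneg[OF T, of D]
    by (intro mult_left_mono) (simp_all add: split inner_add_right DT)
  also have "\<dots> \<le> norm R * (norm D * norm (S ** S - T ** T))"
    by (intro mult_left_mono norm_cauchy_schwarz) simp
  finally have "norm D * norm D \<le> norm D * (norm R * norm (S ** S - T ** T))"
    by (simp add: power2_eq_square mult_ac)
  thus ?thesis
    using False by (simp add: D_def)
qed

lemma pos_def_mat_1: "pos_def (mat 1 :: 'l::finite cmat)"
  unfolding pos_def_def
proof (intro conjI allI impI)
  fix x :: "complex ^ 'l"
  assume "x \<noteq> 0"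
  hence "0 < x \<bullet> x" by simp
  thus "0 < Re (\<Sum>i\<in>UNIV. cnj (x $ i) * (mat 1 *v x) $ i)"
    by (simp add: inner_vec_def inner_complex_def)
qed simp

text \<open>The square root estimate with \<open>S = 1\<close>, since \<open>A A\<^sup>* = A\<^sup>2\<close>. The constant is the Frobenius norm of
  the identity, the square root of the dimension.\<close>

lemma pos_def_norm_diff_mat_1_le:
  fixes A :: "'l::finite cmat"
  assumes "pos_def A"
  shows "norm (A - mat 1) \<le> norm (mat 1 :: 'l cmat) * norm (mat 1 - A ** conj_transpose A)"
  using pos_def_norm_diff_le[OF pos_def_mat_1 assms, of "mat 1"] assms
  by (simp add: pos_def_hermitian norm_minus_commute)

section \<open>Triangular matrices\<close>

text \<open>Forward substitution: comparing the entries of \<open>L ** R = 1\<close> row by row from the top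
  determines those of \<open>R\<close>.\<close>

lemma lower_triangular_pos_inverse:
  fixes L R :: "'l::{finite,linorder} cmat"
  assumes L: "lower_triangular_pos L" and inv: "L ** R = mat 1"
  shows "i < j \<Longrightarrow> R $ i $ j = 0" and "L $ i $ i * R $ i $ i = 1"
proof -
  have upper: "L $ i $ j = 0" if "i < j" for i j
    using L that by (simp add: lower_triangular_pos_def)
  have diag: "L $ i $ i \<noteq> 0" for i
    using L by (auto simp: lower_triangular_pos_def complex_eq_iff) (metis less_irrefl)
  have sub: "(\<Sum>k\<in>UNIV. L $ i $ k * R $ k $ j) = L $ i $ i * R $ i $ j"
    if "\<And>k. k < i \<Longrightarrow> R $ k $ j = 0" for i j
  proof -
    have "(\<Sum>k\<in>UNIV. L $ i $ k * R $ k $ j) = (\<Sum>k\<in>{i}. L $ i $ k * R $ k $ j)"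
    proof (rule sum.mono_neutral_right)
      show "\<forall>k\<in>UNIV - {i}. L $ i $ k * R $ k $ j = 0"
      proof
        fix k assume "k \<in> UNIV - {i}"
        hence "k < i \<or> i < k" by auto
        thus "L $ i $ k * R $ k $ j = 0" using that upper by auto
      qed
    qed auto
    thus ?thesis by simp
  qed
  have LR: "(\<Sum>k\<in>UNIV. L $ i $ k * R $ k $ j) = (if i = j then 1 else 0)" for i j
    using arg_cong[OF inv, of "\<lambda>M. M $ i $ j"] by (simp add: matrix_mult_entry mat_def)
  have zero: "i < j \<longrightarrow> R $ i $ j = 0" for i j
    \<comment> \<open>The number of smaller indices is the position of the row.\<close>
  proof (induction "card {k. k < i}" arbitrary: i rule: less_induct)
    case less
    show ?case
    proof
      assume ij: "i < j"
      have IH: "R $ k $ j = 0" if "k < i" for k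
      proof -
        have "{m. m < k} \<subset> {m. m < i}"
          using that by auto
        hence "card {m. m < k} < card {m. m < i}"
          by (intro psubset_card_mono) auto
        thus ?thesis
          using less that ij by auto
      qed
      show "R $ i $ j = 0"
        using sub[of i j, OF IH] LR[of i j] less_imp_neq[OF ij] diag[of i] by simp
    qed
  qed
  thus "i < j \<Longrightarrow> R $ i $ j = 0" by blast
  show "L $ i $ i * R $ i $ i = 1"
    using sub[of i i] LR[of i i] zero by simp
qed

text \<open>The comparison holds entry by entry. Off the diagonal \<open>L\<^sup>*\<close> and \<open>R\<close> are supported in
  opposite triangles, so they cannot cancel. On the diagonal stand \<open>d > 0\<close> and \<open>1 / d\<close>, which lie
  on opposite sides of \<open>1\<close>.\<close>

lemma lower_triangular_pos_norm_diff_mat_1_le_inverse: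
  fixes L R :: "'l::{finite,linorder} cmat"
  assumes L: "lower_triangular_pos L" and inv: "L ** R = mat 1"
  shows "norm (L - mat 1) \<le> norm (conj_transpose L - R)"
proof -
  have diag: "norm (cnj (L $ i $ i) - 1) \<le> norm (cnj (L $ i $ i) - R $ i $ i)" for i
  proof -
    obtain d where d: "L $ i $ i = complex_of_real d" "0 < d"
      using L by (metis lower_triangular_pos_def complex_is_Real_iff Re_complex_of_real
          of_real_Re)
    have "R $ i $ i = complex_of_real (1 / d)"
      using lower_triangular_pos_inverse(2)[OF L inv, of i] d by (simp add: field_simps)
    moreover have "\<bar>d - 1\<bar> \<le> \<bar>d - 1 / d\<bar>"
    proof -
      have "\<bar>d - 1\<bar> * d \<le> \<bar>d - 1\<bar> * (d + 1)"
        by (intro mult_left_mono) auto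
      also have "\<dots> = \<bar>(d - 1) * (d + 1)\<bar>"
        using d by (simp add: abs_mult)
      also have "(d - 1) * (d + 1) = (d - 1 / d) * d"
        using d by (simp add: field_simps)
      finally show ?thesis
        using d by (simp add: abs_mult)
    qed
    ultimately show ?thesis
      using d(1) by (metis complex_cnj_complex_of_real norm_of_real of_real_1 of_real_diff)
  qed
  have entry: "norm ((conj_transpose L - mat 1) $ i $ j) \<le> norm ((conj_transpose L - R) $ i $ j)"
    for i j
  proof (rule linorder_cases[of i j])
    assume "i < j"
    thus ?thesis
      using lower_triangular_pos_inverse(1)[OF L inv] by (simp add: mat_def)
  next
    assume "i = j"
    thus ?thesis
      using diag by (simp add: mat_def)
  next
    assume "j < i"
    thus ?thesis
      using L by (simp add: mat_def lower_triangular_pos_def)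
  qed
  have "norm (conj_transpose (L - mat 1)) \<le> norm (conj_transpose L - R)"
    unfolding conj_transpose_diff conj_transpose_mat_1
    by (intro norm_le_componentwise_cart entry)
  thus ?thesis
    by (simp add: norm_conj_transpose)
qed

lemma one_le_norm_mat_1: "1 \<le> norm (mat 1 :: 'l::finite cmat)"
proof -
  have "(mat 1 :: 'l cmat) $ i $ i \<noteq> 0" for i
    by (simp add: mat_def)
  hence "(mat 1 :: 'l cmat) \<noteq> 0"
    by (metis zero_index)
  hence "0 < norm (mat 1 :: 'l cmat)"
    by simp
  moreover have "norm (mat 1 :: 'l cmat) * 1 \<le> norm (mat 1 :: 'l cmat) * norm (mat 1 :: 'l cmat)"
    using norm_matrix_mult_le[of "mat 1 :: 'l cmat" "mat 1"] by simp
  ultimately show ?thesis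
    by (simp only: mult_le_cancel_left_pos)
qed

text \<open>If \<open>R\<close> is the inverse of \<open>L\<close> and \<open>E\<close> the defect, then \<open>R - L\<^sup>* = R E\<close>. By the entrywise
  comparison \<open>\<parallel>L - 1\<parallel> \<le> \<parallel>R\<parallel> \<parallel>E\<parallel>\<close>, so only a bound on \<open>R\<close> is missing. The same
  identity gives \<open>\<parallel>R\<parallel> \<le> 2 \<parallel>L\<parallel>\<close> for \<open>\<parallel>E\<parallel> \<le> 1/2\<close>, and \<open>\<parallel>L\<parallel>\<^sup>2\<close> is the trace of
  \<open>L L\<^sup>* = 1 - E\<close>.\<close>

lemma lower_triangular_pos_norm_diff_mat_1_le:
  fixes L :: "'l::{finite,linorder} cmat"
  assumes L: "lower_triangular_pos L" and inv: "invertible L"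
    and small: "norm (mat 1 - L ** conj_transpose L) \<le> 1 / 2"
  shows "norm (L - mat 1)
    \<le> 4 * norm (mat 1 :: 'l cmat) * norm (mat 1 - L ** conj_transpose L)"
proof -
  define E where "E = mat 1 - L ** conj_transpose L"
  define m where "m = norm (mat 1 :: 'l cmat)"
  have m: "1 \<le> m" unfolding m_def by (rule one_le_norm_mat_1)
  obtain R where LR: "L ** R = mat 1" and RL: "R ** L = mat 1"
    using inv by (auto simp: invertible_def)
  have RE: "R ** E = R - conj_transpose L"
    by (simp add: E_def matrix_mult_diff_right matrix_mul_assoc RL)
  have "(norm L)\<^sup>2 = mat 1 \<bullet> (L ** conj_transpose L)"
    using inner_mult_adjoint_right[of "mat 1" L L] by (simp add: power2_norm_eq_inner)
  also have "\<dots> \<le> m * norm (L ** conj_transpose L)"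
    unfolding m_def by (rule norm_cauchy_schwarz)
  also have "\<dots> \<le> m * (m + 1 / 2)"
    using norm_triangle_ineq4[of "mat 1" E] small m
    by (intro mult_left_mono) (simp_all add: E_def m_def)
  also have "\<dots> \<le> (2 * m)\<^sup>2"
    using m by (simp add: power2_eq_square algebra_simps)
  finally have normL: "norm L \<le> 2 * m"
    by (rule power2_le_imp_le) (use m in simp)
  have "norm R \<le> norm (conj_transpose L) + norm (R ** E)"
    using norm_triangle_ineq[of "conj_transpose L" "R ** E"] by (simp add: RE)
  also have "norm (R ** E) \<le> norm R * norm E"
    by (rule norm_matrix_mult_le)
  also have "\<dots> \<le> norm R * (1 / 2)"
    using small by (intro mult_left_mono) (simp_all add: E_def)
  finally have normR: "norm R \<le> 4 * m"
    using normL by (simp add: norm_conj_transpose)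
  have "norm (L - mat 1) \<le> norm (R ** E)"
    using lower_triangular_pos_norm_diff_mat_1_le_inverse[OF L LR]
    by (simp add: RE norm_minus_commute)
  also have "\<dots> \<le> norm R * norm E"
    by (rule norm_matrix_mult_le)
  also have "\<dots> \<le> 4 * m * norm E"
    by (intro mult_right_mono normR) simp
  finally show ?thesis
    by (simp add: E_def m_def)
qed

section \<open>Infinite products of matrices\<close>

text \<open>The sequence is bounded by \<open>\<parallel>X\<^sub>0\<parallel> \<Prod> (1 + a\<^sub>i)\<close>, hence by \<open>\<parallel>X\<^sub>0\<parallel> exp (\<Sum> a\<^sub>i)\<close>; the
  increments are then absolutely summable. The relative form covers products that grow on the left
  as well as those that grow on the right.\<close>

lemma convergent_if_summable_relative_increments:
  fixes X :: "nat \<Rightarrow> 'a::banach"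
  assumes a: "summable a"
    and X: "\<And>n. norm (X (Suc n) - X n) \<le> a n * norm (X n)"
    and nonneg: "\<And>n. 0 \<le> a n"
  shows "convergent X"
proof -
  define C where "C = norm (X 0) * exp (suminf a)"
  have "norm (X n) \<le> norm (X 0) * exp (\<Sum>i<n. a i)" for n
  proof (induction n)
    case (Suc n)
    have "norm (X (Suc n)) \<le> norm (X (Suc n) - X n) + norm (X n)"
      by (metis diff_add_cancel norm_triangle_ineq)
    also have "\<dots> \<le> (1 + a n) * norm (X n)"
      using X[of n] by (simp add: algebra_simps)
    also have "\<dots> \<le> exp (a n) * (norm (X 0) * exp (\<Sum>i<n. a i))"
      using Suc nonneg[of n] by (intro mult_mono) (simp_all add: exp_ge_add_one_self)
    finally show ?case
      by (simp add: exp_add mult_ac)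
  qed simp
  also have "norm (X 0) * exp (\<Sum>i<n. a i) \<le> C" for n
    unfolding C_def using a nonneg by (intro mult_left_mono) (simp_all add: sum_le_suminf)
  finally have bound: "norm (X n) \<le> C" for n .
  have "summable (\<lambda>n. X (Suc n) - X n)"
  proof (rule summable_comparison_test')
    show "summable (\<lambda>n. a n * C)"
      using a by (rule summable_mult2)
    show "norm (X (Suc n) - X n) \<le> a n * C" for n
      using X[of n] mult_left_mono[OF bound nonneg, of n n] by linarith
  qed
  hence "convergent (\<lambda>n. (X n - X 0) + X 0)"
    unfolding summable_iff_convergent sum_lessThan_telescope
    by (intro convergent_add convergent_const)
  thus ?thesis by simp
qed

lemma convergent_ordered_prod:
  fixes A :: "nat \<Rightarrow> 'l::finite cmat"
  assumes "summable (\<lambda>n. norm (A (Suc n) - mat 1))"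
  shows "convergent (ordered_prod A)"
proof (rule convergent_if_summable_relative_increments[OF assms])
  fix n
  have "ordered_prod A (Suc n) - ordered_prod A n = ordered_prod A n ** (A (Suc n) - mat 1)"
    by (simp add: matrix_mult_diff_right)
  thus "norm (ordered_prod A (Suc n) - ordered_prod A n)
      \<le> norm (A (Suc n) - mat 1) * norm (ordered_prod A n)"
    by (metis mult.commute norm_matrix_mult_le)
qed simp

primrec ordered_prod_inv :: "(nat \<Rightarrow> 'l::finite cmat) \<Rightarrow> nat \<Rightarrow> 'l cmat" where
  "ordered_prod_inv A 0 = mat 1"
| "ordered_prod_inv A (Suc n) = matrix_inv (A (Suc n)) ** ordered_prod_inv A n"

lemma invertible_matrix_inv:
  assumes "invertible A"
  shows "A ** matrix_inv A = mat 1" and "matrix_inv A ** A = mat 1"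
  using assms someI_ex[of "\<lambda>B. A ** B = mat 1 \<and> B ** A = mat 1"]
  unfolding invertible_def matrix_inv_def by blast+

lemma ordered_prod_inverse:
  assumes "\<And>n. invertible (A (Suc n))"
  shows "ordered_prod A n ** ordered_prod_inv A n = mat 1"
    and "ordered_prod_inv A n ** ordered_prod A n = mat 1"
proof (induction n)
  case (Suc n)
  note inv = invertible_matrix_inv[OF assms[of n]]
  {
    case 1
    have "ordered_prod A (Suc n) ** ordered_prod_inv A (Suc n)
        = ordered_prod A n ** (A (Suc n) ** matrix_inv (A (Suc n))) ** ordered_prod_inv A n"
      by (simp add: matrix_mul_assoc)
    thus ?case by (simp add: inv Suc)
  next
    case 2
    have "ordered_prod_inv A (Suc n) ** ordered_prod A (Suc n)
        = matrix_inv (A (Suc n)) ** (ordered_prod_inv A n ** ordered_prod A n) ** A (Suc n)"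
      by (simp add: matrix_mul_assoc)
    thus ?case by (simp add: inv Suc)
  }
qed simp_all

text \<open>From \<open>R (A - 1) = 1 - R\<close> for the inverse \<open>R\<close> of \<open>A\<close>; used first to bound \<open>R\<close> and then to
  estimate \<open>R - 1\<close>.\<close>

lemma norm_matrix_inv_diff_mat_1_le:
  fixes A :: "'l::finite cmat"
  assumes "invertible A" and small: "norm (A - mat 1) \<le> 1 / 2"
  shows "norm (matrix_inv A - mat 1) \<le> 2 * norm (mat 1 :: 'l cmat) * norm (A - mat 1)"
proof -
  define R where "R = matrix_inv A"
  have R: "R ** (A - mat 1) = mat 1 - R"
    by (simp add: R_def matrix_mult_diff_right invertible_matrix_inv[OF assms(1)])
  have le: "norm (mat 1 - R) \<le> norm R * norm (A - mat 1)"
    by (metis R norm_matrix_mult_le)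
  also have "\<dots> \<le> norm R * (1 / 2)"
    using small by (intro mult_left_mono) simp_all
  finally have "norm R \<le> 2 * norm (mat 1 :: 'l cmat)"
    using norm_triangle_ineq2[of R "mat 1"] by (simp add: norm_minus_commute)
  hence "norm R * norm (A - mat 1) \<le> 2 * norm (mat 1 :: 'l cmat) * norm (A - mat 1)"
    by (rule mult_right_mono) simp
  with le show ?thesis
    by (simp add: R_def norm_minus_commute)
qed

lemma convergent_ordered_prod_inv:
  fixes A :: "nat \<Rightarrow> 'l::finite cmat"
  assumes sum: "summable (\<lambda>n. norm (A (Suc n) - mat 1))"
    and inv: "\<And>n. invertible (A (Suc n))"
  shows "convergent (ordered_prod_inv A)"
proof (rule convergent_if_summable_relative_increments)
  have "eventually (\<lambda>n. norm (A (Suc n) - mat 1) < 1 / 2) sequentially"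
    by (rule order_tendstoD(2)[OF summable_LIMSEQ_zero[OF sum]]) simp
  hence "eventually (\<lambda>n. norm (norm (matrix_inv (A (Suc n)) - mat 1))
      \<le> 2 * norm (mat 1 :: 'l cmat) * norm (A (Suc n) - mat 1)) sequentially"
    by eventually_elim (simp add: norm_matrix_inv_diff_mat_1_le[OF inv])
  thus "summable (\<lambda>n. norm (matrix_inv (A (Suc n)) - mat 1))"
    by (rule summable_comparison_test_ev) (rule summable_mult[OF sum])
next
  fix n
  have "ordered_prod_inv A (Suc n) - ordered_prod_inv A n
      = (matrix_inv (A (Suc n)) - mat 1) ** ordered_prod_inv A n"
    by (simp add: matrix_mult_diff_left)
  thus "norm (ordered_prod_inv A (Suc n) - ordered_prod_inv A n)
      \<le> norm (matrix_inv (A (Suc n)) - mat 1) * norm (ordered_prod_inv A n)"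
    by (metis norm_matrix_mult_le)
qed simp

section \<open>Equivalence of block Jacobi matrices\<close>

text \<open>Any two members of an equivalence class are equivalent through the quotient of the unitaries that
  relate them to a common third one.\<close>

lemma equivalent_via_compare:
  assumes "equivalent_via \<sigma> J J'" and "equivalent_via \<tau> J J''"
  shows "equivalent_via (\<lambda>n. conj_transpose (\<sigma> n) ** \<tau> n) J' J''"
proof -
  have s: "conj_transpose (\<sigma> n) ** \<sigma> n = mat 1" "\<sigma> n ** conj_transpose (\<sigma> n) = mat 1"
    if "1 \<le> n" for n
    using assms(1) that by (auto simp: equivalent_via_def unitary_mat_def)
  have cancel: "\<sigma> n ** (conj_transpose (\<sigma> n) ** M) = M" if "1 \<le> n" for n M
    using s(2)[OF that] by (simp add: matrix_mul_assoc)
  show ?thesis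
    using assms
    by (auto simp: equivalent_via_def unitary_mat_mult unitary_mat_conj_transpose
        conj_transpose_mult matrix_mul_assoc[symmetric] cancel)
qed

text \<open>The factors \<open>\<sigma>\<^sub>k \<sigma>\<^sub>k\<^sup>*\<close> inside the product cancel, and \<open>\<sigma>\<^sub>1 = 1\<close> removes the one at the left
  end.\<close>

lemma ordered_prod_equivalent:
  assumes "equivalent_via \<sigma> J J'"
  shows "ordered_prod (jacobi_A J') n = ordered_prod (jacobi_A J) n ** \<sigma> (Suc n)"
proof (induction n)
  case 0
  thus ?case using assms by (simp add: equivalent_via_def)
next
  case (Suc n)
  have s: "\<sigma> (Suc n) ** conj_transpose (\<sigma> (Suc n)) = mat 1"
    using assms by (simp add: equivalent_via_def unitary_mat_def)
  have "jacobi_A J' (Suc n) = conj_transpose (\<sigma> (Suc n)) ** jacobi_A J (Suc n) ** \<sigma> (Suc (Suc n))"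
    using assms by (simp add: equivalent_via_def)
  hence "ordered_prod (jacobi_A J') (Suc n) = ordered_prod (jacobi_A J) n
      ** (\<sigma> (Suc n) ** conj_transpose (\<sigma> (Suc n))) ** jacobi_A J (Suc n) ** \<sigma> (Suc (Suc n))"
    by (simp add: Suc matrix_mul_assoc)
  thus ?case by (simp add: s)
qed

lemma norm_defect_equivalent:
  assumes "equivalent_via \<sigma> J J'"
  shows "norm (mat 1 - jacobi_A J' (Suc n) ** conj_transpose (jacobi_A J' (Suc n)))
    = norm (mat 1 - jacobi_A J (Suc n) ** conj_transpose (jacobi_A J (Suc n)))"
proof -
  let ?s = "\<sigma> (Suc n)" and ?t = "\<sigma> (Suc (Suc n))" and ?A = "jacobi_A J (Suc n)"
  have u: "unitary_mat ?s" "unitary_mat ?t"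
    using assms by (simp_all add: equivalent_via_def)
  have "jacobi_A J' (Suc n) = conj_transpose ?s ** ?A ** ?t"
    using assms by (simp add: equivalent_via_def)
  hence "jacobi_A J' (Suc n) ** conj_transpose (jacobi_A J' (Suc n))
      = conj_transpose ?s ** ?A ** (?t ** conj_transpose ?t) ** conj_transpose ?A ** ?s"
    by (simp add: conj_transpose_mult matrix_mul_assoc)
  also have "\<dots> = conj_transpose ?s ** ?A ** conj_transpose ?A ** ?s"
    using u(2) by (simp add: unitary_mat_def)
  finally have "mat 1 - jacobi_A J' (Suc n) ** conj_transpose (jacobi_A J' (Suc n))
      = conj_transpose ?s ** (mat 1 - ?A ** conj_transpose ?A) ** ?s"
    using u by (simp add: unitary_mat_def matrix_mult_diff_left matrix_mult_diff_right
        matrix_mul_assoc)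
  thus ?thesis
    using u by (simp add: norm_unitary_mult_left norm_unitary_mult_right unitary_mat_conj_transpose)
qed

text \<open>The telescoped product is solved for the unitary, \<open>\<sigma>\<^sub>n\<^sub>+\<^sub>1 = P\<^sub>n\<^sup>-\<^sup>1 P'\<^sub>n\<close>.\<close>

lemma convergent_equivalence:
  assumes J: "block_jacobi J" and J': "equivalent_via \<sigma> J J'"
    and R: "convergent (ordered_prod_inv (jacobi_A J))"
    and P: "convergent (ordered_prod (jacobi_A J'))"
  shows "convergent \<sigma>"
proof -
  have "\<sigma> (Suc n) = ordered_prod_inv (jacobi_A J) n ** ordered_prod (jacobi_A J') n" for n
  proof -
    have inv: "ordered_prod_inv (jacobi_A J) n ** ordered_prod (jacobi_A J) n = mat 1"
      using J by (intro ordered_prod_inverse) (simp add: block_jacobi_def)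
    show ?thesis
      by (simp add: ordered_prod_equivalent[OF J'] matrix_mul_assoc inv)
  qed
  hence "convergent (\<lambda>n. \<sigma> (Suc n))"
    using convergent_matrix_mult[OF R P] by simp
  thus ?thesis
    by (simp add: convergent_Suc_iff)
qed

lemma summable_defect_equivalent:
  assumes "summable (\<lambda>n. op_norm (mat 1 - jacobi_A J (n + 1) ** conj_transpose (jacobi_A J (n + 1)))
      + op_norm (jacobi_B J (n + 1)))"
    and eq: "equivalent_via \<sigma> J J'"
  shows "summable (\<lambda>n. norm (mat 1 - jacobi_A J' (Suc n) ** conj_transpose (jacobi_A J' (Suc n))))"
proof (rule summable_comparison_test'[OF summable_mult[OF assms(1)]])
  fix n
  let ?E = "mat 1 - jacobi_A J (Suc n) ** conj_transpose (jacobi_A J (Suc n))"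
  have "norm (mat 1 - jacobi_A J' (Suc n) ** conj_transpose (jacobi_A J' (Suc n))) = norm ?E"
    by (rule norm_defect_equivalent[OF eq])
  also have "\<dots> \<le> real (CARD('a) * CARD('a)) * op_norm ?E"
    by (rule norm_le_op_norm)
  also have "\<dots> \<le> real (CARD('a) * CARD('a)) * (op_norm ?E + op_norm (jacobi_B J (Suc n)))"
    by (intro mult_left_mono) (simp_all add: op_norm_def onorm_pos_le)
  finally show "norm (norm (mat 1 - jacobi_A J' (Suc n) ** conj_transpose (jacobi_A J' (Suc n))))
    \<le> real (CARD('a) * CARD('a)) * (op_norm (mat 1 - jacobi_A J (n + 1)
        ** conj_transpose (jacobi_A J (n + 1))) + op_norm (jacobi_B J (n + 1)))"
    by simp
qed

section \<open>Asymptotics of the three types\<close>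

lemma type1_summable:
  assumes "type1 J"
    and sum: "summable (\<lambda>n. norm (mat 1 - jacobi_A J (Suc n) ** conj_transpose (jacobi_A J (Suc n))))"
  shows "summable (\<lambda>n. norm (jacobi_A J (Suc n) - mat 1))"
proof (rule summable_comparison_test'[OF summable_mult[OF sum]])
  fix n
  have "pos_def (jacobi_A J (Suc n))"
    using assms(1) by (simp add: type1_def)
  from pos_def_norm_diff_mat_1_le[OF this]
  show "norm (norm (jacobi_A J (Suc n) - mat 1)) \<le> norm (mat 1 :: 'a cmat)
      * norm (mat 1 - jacobi_A J (Suc n) ** conj_transpose (jacobi_A J (Suc n)))"
    by simp
qed

lemma type3_summable:
  fixes J :: "'l::{finite,linorder} block_matrix"
  assumes J: "type3 J"
    and sum: "summable (\<lambda>n. norm (mat 1 - jacobi_A J (Suc n) ** conj_transpose (jacobi_A J (Suc n))))"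
  shows "summable (\<lambda>n. norm (jacobi_A J (Suc n) - mat 1))"
proof (rule summable_comparison_test_ev)
  have J': "lower_triangular_pos (jacobi_A J (Suc n))" "invertible (jacobi_A J (Suc n))" for n
    using J by (simp_all add: type3_def block_jacobi_def)
  have "eventually (\<lambda>n. norm (mat 1 - jacobi_A J (Suc n) ** conj_transpose (jacobi_A J (Suc n)))
      < 1 / 2) sequentially"
    by (rule order_tendstoD(2)[OF summable_LIMSEQ_zero[OF sum]]) simp
  thus "eventually (\<lambda>n. norm (norm (jacobi_A J (Suc n) - mat 1)) \<le> 4 * norm (mat 1 :: 'l cmat)
      * norm (mat 1 - jacobi_A J (Suc n) ** conj_transpose (jacobi_A J (Suc n)))) sequentially"
    by eventually_elim (simp add: lower_triangular_pos_norm_diff_mat_1_le[OF J'])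
qed (rule summable_mult[OF sum])

text \<open>Here \<open>P\<close> and \<open>Q\<close> are the products for \<open>J\<close> and \<open>J'\<close>. Since \<open>Q\<^sub>n = P\<^sub>n \<sigma>\<^sub>n\<^sub>+\<^sub>1\<close> is
  Hermitian, \<open>Q\<^sub>n\<^sup>2 = P\<^sub>n P\<^sub>n\<^sup>*\<close> converges. The inverse \<open>\<sigma>\<^sub>n\<^sub>+\<^sub>1\<^sup>* P\<^sub>n\<^sup>-\<^sup>1\<close> of \<open>Q\<^sub>n\<close> has the norm of
  \<open>P\<^sub>n\<^sup>-\<^sup>1\<close>, which is bounded, so the square root is uniformly Lipschitz along the sequence and
  \<open>Q\<^sub>n\<close> is Cauchy.\<close>

lemma type2_convergent_ordered_prod:
  assumes J: "block_jacobi J" and J': "type2 J'" and eq: "equivalent_via \<sigma> J J'"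
    and P: "convergent (ordered_prod (jacobi_A J))"
    and R: "convergent (ordered_prod_inv (jacobi_A J))"
  shows "convergent (ordered_prod (jacobi_A J'))"
proof -
  define P where "P = ordered_prod (jacobi_A J)"
  define Q where "Q = ordered_prod (jacobi_A J')"
  define R where "R = ordered_prod_inv (jacobi_A J)"
  have unitary: "unitary_mat (\<sigma> (Suc n))" for n
    using eq by (simp add: equivalent_via_def)
  have Q: "Q n = P n ** \<sigma> (Suc n)" for n
    unfolding P_def Q_def by (rule ordered_prod_equivalent[OF eq])
  have pos: "pos_def (Q n)" for n
    using J' unfolding type2_def Q_def
    by (cases "n = 0") (simp_all add: pos_def_mat_1)
  have inv: "Q n ** (conj_transpose (\<sigma> (Suc n)) ** R n) = mat 1" for n
  proof -
    have "P n ** R n = mat 1"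
      using J unfolding P_def R_def by (intro ordered_prod_inverse) (simp add: block_jacobi_def)
    moreover have "Q n ** (conj_transpose (\<sigma> (Suc n)) ** R n)
        = P n ** (\<sigma> (Suc n) ** conj_transpose (\<sigma> (Suc n))) ** R n"
      by (simp add: Q matrix_mul_assoc)
    ultimately show ?thesis
      using unitary[of n] by (simp add: unitary_mat_def)
  qed
  have square: "Q n ** Q n = P n ** conj_transpose (P n)" for n
  proof -
    have "Q n ** Q n = Q n ** conj_transpose (Q n)"
      by (simp add: pos_def_hermitian[OF pos])
    also have "\<dots> = P n ** (\<sigma> (Suc n) ** conj_transpose (\<sigma> (Suc n))) ** conj_transpose (P n)"
      by (simp add: Q conj_transpose_mult matrix_mul_assoc)
    finally show ?thesis
      using unitary[of n] by (simp add: unitary_mat_def)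
  qed
  obtain K where K: "0 < K" "\<And>n. norm (R n) \<le> K"
    using convergent_imp_Bseq[OF R] by (auto simp: R_def elim: BseqE)
  have "convergent (\<lambda>n. Q n ** Q n)"
    unfolding square P_def by (intro convergent_matrix_mult convergent_conj_transpose P)
  hence cauchy: "Cauchy (\<lambda>n. Q n ** Q n)"
    by (rule convergent_Cauchy)
  have diff: "norm (Q m - Q n) \<le> K * norm (Q m ** Q m - Q n ** Q n)" for m n
  proof -
    have "norm (Q m - Q n) \<le> norm (conj_transpose (\<sigma> (Suc m)) ** R m)
        * norm (Q m ** Q m - Q n ** Q n)"
      by (rule pos_def_norm_diff_le[OF pos pos inv])
    also have "norm (conj_transpose (\<sigma> (Suc m)) ** R m) = norm (R m)"
      by (intro norm_unitary_mult_left unitary_mat_conj_transpose unitary)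
    also have "norm (R m) * norm (Q m ** Q m - Q n ** Q n) \<le> K * norm (Q m ** Q m - Q n ** Q n)"
      by (intro mult_right_mono K(2)) simp
    finally show ?thesis .
  qed
  have "Cauchy Q"
  proof (rule CauchyI)
    fix e :: real
    assume "0 < e"
    hence "0 < e / K" using K(1) by simp
    then obtain N where N: "\<And>m n. m \<ge> N \<Longrightarrow> n \<ge> N \<Longrightarrow> norm (Q m ** Q m - Q n ** Q n) < e / K"
      using CauchyD[OF cauchy] by blast
    show "\<exists>N. \<forall>m\<ge>N. \<forall>n\<ge>N. norm (Q m - Q n) < e"
    proof (intro exI[of _ N] allI impI)
      fix m n assume "N \<le> m" "N \<le> n"
      hence "K * norm (Q m ** Q m - Q n ** Q n) < e"
        using N[of m n] K(1) by (simp add: field_simps)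
      thus "norm (Q m - Q n) < e"
        using diff[of m n] by linarith
    qed
  qed
  thus ?thesis
    by (simp add: Q_def Cauchy_convergent_iff)
qed

theorem theorem2:
  fixes J J1 J2 J3 :: "'l::{finite,linorder} block_matrix"
  assumes "block_jacobi J"
    and "summable (\<lambda>n. op_norm (mat 1 - jacobi_A J (n + 1) ** conj_transpose (jacobi_A J (n + 1)))
                      + op_norm (jacobi_B J (n + 1)))"
    and "type1 J1" and "jacobi_equivalent J J1"
    and "type2 J2" and "jacobi_equivalent J J2"
    and "type3 J3" and "jacobi_equivalent J J3"
  shows "jacobi_asymptotic J1 J2 \<and> jacobi_asymptotic J1 J3 \<and> jacobi_asymptotic J2 J3"
proof -
  obtain \<sigma>1 \<sigma>2 \<sigma>3 where eq: "equivalent_via \<sigma>1 J J1" "equivalent_via \<sigma>2 J J2" "equivalent_via \<sigma>3 J J3"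
    using assms by (auto simp: jacobi_equivalent_def)
  have jacobi: "block_jacobi J1" "block_jacobi J2" "block_jacobi J3"
    using assms by (auto simp: jacobi_equivalent_def)
  define \<tau>2 where "\<tau>2 = (\<lambda>n. conj_transpose (\<sigma>1 n) ** \<sigma>2 n)"
  define \<tau>3 where "\<tau>3 = (\<lambda>n. conj_transpose (\<sigma>1 n) ** \<sigma>3 n)"
  have eq12: "equivalent_via \<tau>2 J1 J2" and eq13: "equivalent_via \<tau>3 J1 J3"
    unfolding \<tau>2_def \<tau>3_def
    by (rule equivalent_via_compare[OF eq(1) eq(2)], rule equivalent_via_compare[OF eq(1) eq(3)])
  have sum1: "summable (\<lambda>n. norm (jacobi_A J1 (Suc n) - mat 1))"
    by (intro type1_summable assms(3) summable_defect_equivalent[OF assms(2) eq(1)])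
  have sum3: "summable (\<lambda>n. norm (jacobi_A J3 (Suc n) - mat 1))"
    by (intro type3_summable assms(7) summable_defect_equivalent[OF assms(2) eq(3)])
  have P1: "convergent (ordered_prod (jacobi_A J1))"
    by (rule convergent_ordered_prod[OF sum1])
  have R1: "convergent (ordered_prod_inv (jacobi_A J1))"
    using jacobi(1) by (intro convergent_ordered_prod_inv sum1) (simp add: block_jacobi_def)
  have P2: "convergent (ordered_prod (jacobi_A J2))"
    by (rule type2_convergent_ordered_prod[OF jacobi(1) assms(5) eq12 P1 R1])
  have P3: "convergent (ordered_prod (jacobi_A J3))"
    by (rule convergent_ordered_prod[OF sum3])
  have conv2: "convergent \<tau>2"
    by (rule convergent_equivalence[OF jacobi(1) eq12 R1 P2])
  have conv3: "convergent \<tau>3"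
    by (rule convergent_equivalence[OF jacobi(1) eq13 R1 P3])
  have "convergent (\<lambda>n. conj_transpose (\<tau>2 n) ** \<tau>3 n)"
    by (intro convergent_matrix_mult convergent_conj_transpose conv2 conv3)
  hence "jacobi_asymptotic J2 J3"
    using jacobi equivalent_via_compare[OF eq12 eq13] unfolding jacobi_asymptotic_def by blast
  thus ?thesis
    using jacobi eq12 eq13 conv2 conv3 by (auto simp: jacobi_asymptotic_def)
qed

end
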